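(* Let $\Delta x,\Delta t>0$ and let $\{u^n\}_{n\ge 0}\subset \ell^2(\mathbb{Z})$ be a sequence of grid functions satisfying the Crank–Nicolson scheme $$u_j^{n+1} = u_j^n -\Delta t\, \tilde{u}_j^{n+1/2}\, Du_j^{n+1/2} - \Delta t\, D_-DD_+u^{n+1/2}_j,\qquad n\in\mathbb{N}_0,\ j\in\mathbb{Z}.$$ Then the scheme is $L^2$-conservative: $\|u^{n+1}\|=\|u^n\|$ for all $n\in\mathbb{N}_0$.
   Context: The scheme discretizes the KdV equation $u_t+uu_x+u_{xxx}=0$ on $\mathbb{R}$. Grid: $x_j=j\Delta x$, $j\in\mathbb{Z}$, $t_n=n\Delta t$. For a grid function $v=(v_j)_{j\in\mathbb{Z}}$: $D_+v_j=(v_{j+1}-v_j)/\Delta x$, $D_-v_j=(v_j-v_{j-1})/\Delta x$, $D=\frac12(D_++D_-)$, $\tilde v_j=\frac13(v_{j+1}+v_j+v_{j-1})$. Norm: $\|v\|=\big(\Delta x\sum_{j\in\mathbb{Z}}v_j^2\big)^{1/2}$. Moreover $u^{n+1/2}=\frac12(u^n+u^{n+1})$. *)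

theory Defs
  imports "HOL-Analysis.Analysis"
begin

type_synonym grid_fun = "int \<Rightarrow> real"

definition ell2 :: "grid_fun set" where
  "ell2 = {v. (\<lambda>j. (v j)\<^sup>2) summable_on UNIV}"

(* Without summability the infinite sum takes the default value 0,
   so this is the norm only on ell2. *)
definition grid_norm :: "real \<Rightarrow> grid_fun \<Rightarrow> real" where
  "grid_norm dx v = sqrt (dx * (\<Sum>\<^sub>\<infinity>j\<in>UNIV. (v j)\<^sup>2))"

definition D_plus :: "real \<Rightarrow> grid_fun \<Rightarrow> grid_fun" where
  "D_plus dx v = (\<lambda>j. (v (j + 1) - v j) / dx)"

definition D_minus :: "real \<Rightarrow> grid_fun \<Rightarrow> grid_fun" where
  "D_minus dx v = (\<lambda>j. (v j - v (j - 1)) / dx)"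

definition D_central :: "real \<Rightarrow> grid_fun \<Rightarrow> grid_fun" where
  "D_central dx v = (\<lambda>j. (1 / 2) * (D_plus dx v j + D_minus dx v j))"

definition grid_avg :: "grid_fun \<Rightarrow> grid_fun" where
  "grid_avg v = (\<lambda>j. (1 / 3) * (v (j + 1) + v j + v (j - 1)))"

definition time_mid :: "(nat \<Rightarrow> grid_fun) \<Rightarrow> nat \<Rightarrow> grid_fun" where
  "time_mid u n = (\<lambda>j. (1 / 2) * (u n j + u (n + 1) j))"

definition crank_nicolson_kdv :: "real \<Rightarrow> real \<Rightarrow> (nat \<Rightarrow> grid_fun) \<Rightarrow> bool" where
  "crank_nicolson_kdv dx dt u \<longleftrightarrow>
     (\<forall>n j. u (n + 1) j = u n j
        - dt * grid_avg (time_mid u n) j * D_central dx (time_mid u n) j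
        - dt * D_minus dx (D_central dx (D_plus dx (time_mid u n))) j)"

end

theory Submission
  imports Defs
begin

text \<open>
  With \<open>w\<close> the mean of two consecutive time levels, the increment of the square of the solution is
  \<open>2 * w\<close> times the increment of the solution, so it suffices that \<open>w\<close> is orthogonal in
  \<open>ell2\<close> to both spatial terms of the scheme, for every \<open>w\<close> in \<open>ell2\<close>. This is summation by parts:
  the product of \<open>w\<close> with either term is a forward difference of an explicit flux
  (\<open>convection_flux_difference\<close>, \<open>dispersion_flux_difference\<close>). For the convective term this
  depends on the three-point average: \<open>w j * grid_avg w j * D_central dx w j\<close> is the quotient
  \<open>w j * ((w (j + 1))\<^sup>2 - (w (j - 1))\<^sup>2 + w j * (w (j + 1) - w (j - 1))) / (6 * dx)\<close>,
  whose expansion consists of cubic monomials that cancel in pairs after a shift. The fluxes are quadratic or cubic in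
  entries of \<open>w\<close>. Products of two \<open>ell2\<close> functions are summable and \<open>ell2\<close> functions are bounded,
  so the fluxes are summable and their differences sum to zero.
\<close>

lemma ell2_shift:
  assumes "v \<in> ell2"
  shows "(\<lambda>j. v (j + k)) \<in> ell2"
proof -
  have "bij_betw (\<lambda>j::int. j + k) UNIV UNIV"
    by (rule bij_betwI[where g = "\<lambda>j. j - k"]) auto
  from summable_on_reindex_bij_betw[OF this, of "\<lambda>j. (v j)\<^sup>2"] show ?thesis
    using assms by (simp add: ell2_def)
qed

lemma ell2_mult_summable:
  assumes "v \<in> ell2" "w \<in> ell2"
  shows "(\<lambda>j. v j * w j) summable_on UNIV"
proof -
  have "(\<lambda>j. norm (v j * w j)) summable_on UNIV"
    by (rule abs_summable_product)
      (use assms in \<open>simp_all add: ell2_def power2_eq_square\<close>)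
  then show ?thesis
    by (rule abs_summable_summable)
qed

lemma ell2_scale:
  assumes "v \<in> ell2"
  shows "(\<lambda>j. c * v j) \<in> ell2"
  using assms by (simp add: ell2_def power_mult_distrib summable_on_cmult_right)

lemma ell2_add:
  assumes "v \<in> ell2" "w \<in> ell2"
  shows "(\<lambda>j. v j + w j) \<in> ell2"
proof -
  have "(\<lambda>j. (v j)\<^sup>2 + (w j)\<^sup>2 + 2 * (v j * w j)) summable_on UNIV"
    using assms ell2_mult_summable[OF assms]
    by (intro summable_on_add summable_on_cmult_right) (simp_all add: ell2_def)
  then show ?thesis
    by (simp add: ell2_def power2_sum mult.assoc)
qed

text \<open>Square-summable functions are bounded, which reduces the product to a multiple of one factor.\<close>

lemma ell2_mult_closed:
  assumes "v \<in> ell2" "w \<in> ell2"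
  shows "(\<lambda>j. v j * w j) \<in> ell2"
proof -
  define B where "B = (\<Sum>\<^sub>\<infinity>i\<in>UNIV. (v i)\<^sup>2)"
  have bound: "(v j)\<^sup>2 \<le> B" for j
    using finite_sum_le_infsum[of "\<lambda>i. (v i)\<^sup>2" UNIV "{j}"] assms(1)
    by (simp add: B_def ell2_def)
  have "(\<lambda>j. B * (w j)\<^sup>2) summable_on UNIV"
    using assms(2) by (intro summable_on_cmult_right) (simp add: ell2_def)
  then have "(\<lambda>j. (v j * w j)\<^sup>2) summable_on UNIV"
    by (rule summable_on_comparison_test)
      (auto simp: power_mult_distrib intro!: mult_right_mono bound)
  then show ?thesis
    by (simp add: ell2_def)
qed

lemma summable_on_diff:
  fixes f g :: "'a \<Rightarrow> real"
  assumes "f summable_on A" "g summable_on A"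
  shows "(\<lambda>x. f x - g x) summable_on A"
  using summable_on_add[of f A "\<lambda>x. - g x"] assms by (simp add: summable_on_uminus)

lemma infsum_diff:
  fixes f g :: "'a \<Rightarrow> real"
  assumes "f summable_on A" "g summable_on A"
  shows "infsum (\<lambda>x. f x - g x) A = infsum f A - infsum g A"
  using infsum_add[of f A "\<lambda>x. - g x"] assms
  by (simp add: summable_on_uminus infsum_uminus)

lemma infsum_forward_difference:
  fixes f :: grid_fun
  assumes "f summable_on UNIV"
  shows "(\<lambda>j. f (j + 1) - f j) summable_on UNIV"
    and "(\<Sum>\<^sub>\<infinity>j\<in>UNIV. f (j + 1) - f j) = 0"
proof -
  have bij: "bij_betw (\<lambda>j::int. j + 1) UNIV UNIV"
    by (rule bij_betwI[where g = "\<lambda>j. j - 1"]) auto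
  have shifted: "(\<lambda>j. f (j + 1)) summable_on UNIV"
    using summable_on_reindex_bij_betw[OF bij, of f] assms by simp
  show "(\<lambda>j. f (j + 1) - f j) summable_on UNIV"
    using shifted assms by (rule summable_on_diff)
  show "(\<Sum>\<^sub>\<infinity>j\<in>UNIV. f (j + 1) - f j) = 0"
    using infsum_diff[OF shifted assms] infsum_reindex_bij_betw[OF bij, of f] by simp
qed

definition convection_flux :: "real \<Rightarrow> grid_fun \<Rightarrow> grid_fun" where
  "convection_flux dx w = (\<lambda>j. w (j - 1) * (w j * (w (j - 1) + w j)) / (6 * dx))"

definition dispersion_flux :: "real \<Rightarrow> grid_fun \<Rightarrow> grid_fun" where
  "dispersion_flux dx w =
     (\<lambda>j. (w (j - 1) * w (j + 1) + w (j - 2) * w j - 2 * (w (j - 1) * w j)) / (2 * dx ^ 3))"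

lemma convection_flux_difference:
  assumes "dx \<noteq> 0"
  shows "w j * (grid_avg w j * D_central dx w j)
           = convection_flux dx w (j + 1) - convection_flux dx w j"
  using assms
  by (simp add: grid_avg_def D_central_def D_plus_def D_minus_def convection_flux_def
      field_simps)

text \<open>
  The operator is antisymmetric with stencil \<open>(-1, 2, 0, -2, 1) / (2 * dx ^ 3)\<close>. After
  multiplication by \<open>w j\<close>, the pair of opposite entries at offsets \<open>k\<close> and \<open>- k\<close> yields a multiple
  of a \<open>k\<close>-step difference of \<open>w j * w (j + k)\<close>; for \<open>k = 2\<close> this
  is a one-step difference of the sum of two neighbouring products, whence the three terms of
  the flux.
\<close>

lemma dispersion_flux_difference:
  assumes "dx \<noteq> 0"
  shows "w j * D_minus dx (D_central dx (D_plus dx w)) j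
           = dispersion_flux dx w (j + 1) - dispersion_flux dx w j"
  using assms
  by (simp add: D_central_def D_plus_def D_minus_def dispersion_flux_def
      field_simps power3_eq_cube)

lemma convection_flux_summable:
  assumes "w \<in> ell2"
  shows "convection_flux dx w summable_on UNIV"
proof -
  have prev: "(\<lambda>j. w (j - 1)) \<in> ell2"
    using ell2_shift[OF assms, of "-1"] by simp
  have "(\<lambda>j. w (j - 1) * (w j * (w (j - 1) + w j))) summable_on UNIV"
    by (intro ell2_mult_summable ell2_mult_closed ell2_add assms prev)
  from summable_on_cmult_right[OF this, of "1 / (6 * dx)"] show ?thesis
    by (simp add: convection_flux_def)
qed

lemma dispersion_flux_summable:
  assumes "w \<in> ell2"
  shows "dispersion_flux dx w summable_on UNIV"
proof -
  have shifts: "(\<lambda>j. w (j - 1)) \<in> ell2" "(\<lambda>j. w (j - 2)) \<in> ell2" "(\<lambda>j. w (j + 1)) \<in> ell2"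
    using ell2_shift[OF assms, of "-1"] ell2_shift[OF assms, of "-2"]
      ell2_shift[OF assms, of 1] by simp_all
  have "(\<lambda>j. w (j - 1) * w (j + 1) + w (j - 2) * w j - 2 * (w (j - 1) * w j)) summable_on UNIV"
    by (intro summable_on_diff summable_on_add summable_on_cmult_right
        ell2_mult_summable shifts assms)
  from summable_on_cmult_right[OF this, of "1 / (2 * dx ^ 3)"] show ?thesis
    by (simp add: dispersion_flux_def)
qed

lemma crank_nicolson_energy_balance:
  assumes "dx \<noteq> 0" and "crank_nicolson_kdv dx dt u"
  defines "\<Phi> \<equiv> \<lambda>n j. - 2 * dt * (convection_flux dx (time_mid u n) j
                                + dispersion_flux dx (time_mid u n) j)"
  shows "(u (n + 1) j)\<^sup>2 = (u n j)\<^sup>2 + (\<Phi> n (j + 1) - \<Phi> n j)"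
proof -
  let ?w = "time_mid u n"
  let ?C = "grid_avg ?w j * D_central dx ?w j"
  let ?T = "D_minus dx (D_central dx (D_plus dx ?w)) j"
  have step: "u (n + 1) j - u n j = - dt * (?C + ?T)"
    using assms(2) by (simp add: crank_nicolson_kdv_def algebra_simps)
  have "(u (n + 1) j)\<^sup>2 - (u n j)\<^sup>2 = 2 * ?w j * (u (n + 1) j - u n j)"
    by (simp add: time_mid_def power2_eq_square algebra_simps)
  also have "\<dots> = - 2 * dt * (?w j * ?C + ?w j * ?T)"
    unfolding step by (simp add: algebra_simps)
  also have "\<dots> = \<Phi> n (j + 1) - \<Phi> n j"
    unfolding convection_flux_difference[OF assms(1)] dispersion_flux_difference[OF assms(1)]
    by (simp add: \<Phi>_def algebra_simps)
  finally show ?thesis by simp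
qed

theorem mainTheorem1:
  fixes dx dt :: real and u :: "nat \<Rightarrow> int \<Rightarrow> real"
  assumes "dx > 0" and "dt > 0"
    and "\<And>n. u n \<in> ell2"
    and "crank_nicolson_kdv dx dt u"
  shows "\<forall>n. grid_norm dx (u (n + 1)) = grid_norm dx (u n)"
proof
  fix n
  let ?w = "time_mid u n"
  define \<Phi> where "\<Phi> = (\<lambda>j. - 2 * dt * (convection_flux dx ?w j + dispersion_flux dx ?w j))"
  have balance: "(u (n + 1) j)\<^sup>2 = (u n j)\<^sup>2 + (\<Phi> (j + 1) - \<Phi> j)" for j
    using crank_nicolson_energy_balance[of dx dt u n j] assms(1,4) by (simp add: \<Phi>_def)
  have "?w \<in> ell2"
    unfolding time_mid_def by (intro ell2_scale ell2_add assms(3))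
  then have "\<Phi> summable_on UNIV"
    unfolding \<Phi>_def
    by (intro summable_on_cmult_right summable_on_add
        convection_flux_summable dispersion_flux_summable)
  note flux_difference = infsum_forward_difference[OF this]
  have "(\<lambda>j. (u n j)\<^sup>2) summable_on UNIV"
    using assms(3) by (simp add: ell2_def)
  then have "(\<Sum>\<^sub>\<infinity>j\<in>UNIV. (u (n + 1) j)\<^sup>2) = (\<Sum>\<^sub>\<infinity>j\<in>UNIV. (u n j)\<^sup>2)"
    unfolding balance using flux_difference by (simp add: infsum_add)
  then show "grid_norm dx (u (n + 1)) = grid_norm dx (u n)"
    by (simp add: grid_norm_def)
qed

end
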